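(* Let $\mathbb{X}$ be a finite dimensional real inner product space, $f:\mathbb{X}\to\mathbb{R}$ be $L_f$-smooth, $g:\mathbb{X}\to(-\infty,\infty]$ be proper, lower semicontinuous and bounded below, and let $F:=f+g$ be coercive and bounded below. Let $\{x^k\}_{k\in\mathbb{N}}$ be generated by the PGenls algorithm (described in the context), and let $z^k:=(x^k,x^{k-1})$. Then the following results hold. (i) $\liminf_{k\to\infty}H_\delta(z^k)\ge\lim_{k\to\infty}H_\delta(z^{\ell(k)})$. (ii) For each subsequence $\{x^{k_q}\}_{q\in\mathbb{N}}$ with $\lim_{q\to\infty}x^{k_q}=\widehat{x}$, one has $\limsup_{q\to\infty}H_\delta(z^{k_q})\le H_\delta(\widehat{z})$ for $\widehat{z}=(\widehat{x},\widehat{x})$. (iii) For each $k\ge1$, there is $w^k\in\partial H_\delta(z^k)$ such that $$\|w^k\|\le\sqrt{2}\,\big[(L_f+\tau_{\min}^{-1})(1+\beta_{\max})+2\delta\big]\,\|z^k-z^{k-1}\|.$$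
   Context: $f$ is $L_f$-smooth: differentiable with $L_f$-Lipschitz gradient. $\partial$ is the limiting (Mordukhovich) subdifferential. For $\tau>0$, $\mathcal{P}_\tau g(x):=\arg\min_{z}\{\frac{1}{2\tau}\|z-x\|^2+g(z)\}$. For $\delta>0$ and $z=(x,u)\in\mathbb{X}\times\mathbb{X}$, $H_\delta(z):=F(x)+\frac{\delta}{2}\|x-u\|^2$. $\mathbb{X}\times\mathbb{X}$ carries the product Euclidean norm. $[t]_+:=\max(0,t)$. PGenls algorithm (nonmonotone line search proximal gradient with extrapolation). Parameters: $m\in\mathbb{N}$ (integer $\ge0$), $\delta\in(0,1/2)$, $0<\alpha<\delta/2$, $0<\tau_{\min}\le\frac{1}{2(\alpha+\delta)+L_f}<\tau_{\max}$, $\beta_{\max}\ge0$, $\eta_1,\eta_2\in(0,1)$. Start: $x^0\in\mathrm{dom}\,g$, $x^{-1}=x^0$, $z^0=(x^0,x^{-1})$. Iteration $k=0,1,2,\ldots$ (run indefinitely): choose any $\beta_{k,0}\in[0,\beta_{\max}]$ and $\tau_{k,0}\in[\tau_{\min},\tau_{\max}]$; for $l=0,1,2,\ldots$ set $\beta_k=\beta_{k,0}\eta_1^l$, $\tau_k=\max\{\tau_{k,0}\eta_2^l,\tau_{\min}\}$, $y^k=x^k+\beta_k(x^k-x^{k-1})$, pick $x^{k+1}\in\mathcal{P}_{\tau_k}g(y^k-\tau_k\nabla f(y^k))$, $z^{k+1}=(x^{k+1},x^k)$, and stop the inner loop (accepting $x^{k+1}$) as soon as $H_\delta(z^{k+1})\le\max_{j=[k-m]_+,\ldots,k}H_\delta(z^j)-\frac{\alpha}{2}\|z^{k+1}-z^k\|^2$.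 $\ell(k)$ denotes the largest index in $\arg\max_{j=[k-m]_+,\ldots,k}H_\delta(z^j)$; the sequence $\{H_\delta(z^{\ell(k)})\}_k$ is nonincreasing and bounded below, so its limit exists. *)

theory Defs
  imports "HOL-Analysis.Analysis"
begin

definition finite_dim :: "'a::real_vector itself \<Rightarrow> bool" where
  "finite_dim _ \<longleftrightarrow> (\<exists>B::'a set. finite B \<and> span B = UNIV)"


definition proper_fun :: "('a \<Rightarrow> ereal) \<Rightarrow> bool" where
  "proper_fun g \<longleftrightarrow> (\<forall>x. g x \<noteq> -\<infinity>) \<and> (\<exists>x. g x < \<infinity>)"

definition domain_of :: "('a \<Rightarrow> ereal) \<Rightarrow> 'a set" where
  "domain_of g = {x. g x < \<infinity>}"

definition lower_semicont :: "('a::topological_space \<Rightarrow> ereal) \<Rightarrow> bool" where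
  "lower_semicont g \<longleftrightarrow> (\<forall>x. g x \<le> Liminf (at x) g)"

text \<open>The bound \<open>c\<close> is a real number, so it cannot be \<open>-\<infinity>\<close>.\<close>

definition bounded_below_fun :: "('a \<Rightarrow> ereal) \<Rightarrow> bool" where
  "bounded_below_fun g \<longleftrightarrow> (\<exists>c::real. \<forall>x. ereal c \<le> g x)"

definition coercive :: "('a::real_normed_vector \<Rightarrow> ereal) \<Rightarrow> bool" where
  "coercive F \<longleftrightarrow> (F \<longlongrightarrow> \<infinity>) at_infinity"


definition gradient :: "('a::real_inner \<Rightarrow> real) \<Rightarrow> 'a \<Rightarrow> 'a" where
  "gradient f x = (THE D. GDERIV f x :> D)"

text \<open>The first conjunct says that \<open>f\<close> is differentiable everywhere, so that the
  definite description in \<^const>\<open>gradient\<close> denotes.\<close>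

definition smooth_fun :: "real \<Rightarrow> ('a::real_inner \<Rightarrow> real) \<Rightarrow> bool" where
  "smooth_fun L f \<longleftrightarrow>
     (\<forall>x. GDERIV f x :> gradient f x) \<and> L-lipschitz_on UNIV (gradient f)"


text \<open>The regular (Frechet) subdifferential; \<^term>\<open>at x\<close> excludes the point \<open>x\<close>. The
  limiting (Mordukhovich) subdifferential is its outer limit along \<open>h\<close>-attentive
  convergence. Both are empty at points where \<open>h\<close> is not finite.\<close>

definition regular_subdiff :: "('a::real_inner \<Rightarrow> ereal) \<Rightarrow> 'a \<Rightarrow> 'a set" where
  "regular_subdiff h x =
     {v. \<bar>h x\<bar> \<noteq> \<infinity> \<and>
         0 \<le> Liminf (at x) (\<lambda>y. (h y - h x - ereal (v \<bullet> (y - x))) / ereal (norm (y - x)))}"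

definition limiting_subdiff :: "('a::real_inner \<Rightarrow> ereal) \<Rightarrow> 'a \<Rightarrow> 'a set" where
  "limiting_subdiff h x =
     {v. \<bar>h x\<bar> \<noteq> \<infinity> \<and>
         (\<exists>xs vs. xs \<longlonglongrightarrow> x \<and> (\<lambda>i. h (xs i)) \<longlonglongrightarrow> h x \<and>
                  (\<forall>i. vs i \<in> regular_subdiff h (xs i)) \<and> vs \<longlonglongrightarrow> v)}"

definition prox :: "real \<Rightarrow> ('a::real_normed_vector \<Rightarrow> ereal) \<Rightarrow> 'a \<Rightarrow> 'a set" where
  "prox \<tau> g x =
     {p. is_arg_min (\<lambda>z. ereal (1 / (2 * \<tau>) * (norm (z - x))\<^sup>2) + g z) (\<lambda>_. True) p}"


definition objective :: "('a \<Rightarrow> real) \<Rightarrow> ('a \<Rightarrow> ereal) \<Rightarrow> 'a \<Rightarrow> ereal" where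
  "objective f g x = ereal (f x) + g x"

definition potential ::
  "('a::real_normed_vector \<Rightarrow> ereal) \<Rightarrow> real \<Rightarrow> 'a \<times> 'a \<Rightarrow> ereal" where
  "potential F \<delta> z = F (fst z) + ereal (\<delta> / 2 * (norm (fst z - snd z))\<^sup>2)"

text \<open>\<open>zpair x k\<close> is \<open>z\<^sup>k = (x\<^sup>k, x\<^sup>k\<^sup>-\<^sup>1)\<close>. Since natural number subtraction truncates,
  \<open>x (0 - 1) = x 0\<close>, which is exactly the convention \<open>x\<^sup>-\<^sup>1 = x\<^sup>0\<close>. In the same way
  \<open>k - m\<close> on natural numbers is \<open>[k - m]\<^sub>+\<close> below.\<close>

definition zpair :: "(nat \<Rightarrow> 'a) \<Rightarrow> nat \<Rightarrow> 'a \<times> 'a" where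
  "zpair x k = (x k, x (k - 1))"

text \<open>The line search test in iteration \<open>k\<close> for a candidate \<open>p\<close> for \<open>x\<^sup>k\<^sup>+\<^sup>1\<close>, where \<open>H\<close> is
  the potential.\<close>

definition accepts ::
  "('a::real_normed_vector \<times> 'a \<Rightarrow> ereal) \<Rightarrow> nat \<Rightarrow> real \<Rightarrow> (nat \<Rightarrow> 'a) \<Rightarrow> nat \<Rightarrow> 'a \<Rightarrow> bool" where
  "accepts H m \<alpha> x k p \<longleftrightarrow>
     H (p, x k) \<le> (MAX j\<in>{k - m..k}. H (zpair x j))
                    - ereal (\<alpha> / 2 * (norm ((p, x k) - zpair x k))\<^sup>2)"

text \<open>The point \<open>p l\<close> is the candidate picked in pass \<open>l\<close> of the inner loop, with trial
  parameters \<open>\<beta>0 * \<eta>1 ^ l\<close> and \<open>max (\<tau>0 * \<eta>2 ^ l) \<tau>min\<close>; the first pass whose candidate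
  is accepted is pass \<open>N\<close>.\<close>

definition pgenls_step ::
  "('a::real_inner \<Rightarrow> real) \<Rightarrow> ('a \<Rightarrow> ereal) \<Rightarrow> nat \<Rightarrow> real \<Rightarrow> real \<Rightarrow> real \<Rightarrow> real \<Rightarrow> real \<Rightarrow>
    real \<Rightarrow> real \<Rightarrow> (nat \<Rightarrow> 'a) \<Rightarrow> nat \<Rightarrow> bool" where
  "pgenls_step f g m \<delta> \<alpha> \<tau>min \<tau>max \<beta>max \<eta>1 \<eta>2 x k \<longleftrightarrow>
     (\<exists>\<beta>0 \<in> {0..\<beta>max}. \<exists>\<tau>0 \<in> {\<tau>min..\<tau>max}. \<exists>(p :: nat \<Rightarrow> 'a) N.
        (\<forall>l\<le>N.
           let \<beta> = \<beta>0 * \<eta>1 ^ l;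
               \<tau> = max (\<tau>0 * \<eta>2 ^ l) \<tau>min;
               y = x k + \<beta> *\<^sub>R (x k - x (k - 1))
           in p l \<in> prox \<tau> g (y - \<tau> *\<^sub>R gradient f y)) \<and>
        (\<forall>l<N. \<not> accepts (potential (objective f g) \<delta>) m \<alpha> x k (p l)) \<and>
        accepts (potential (objective f g) \<delta>) m \<alpha> x k (p N) \<and>
        x (Suc k) = p N)"

definition pgenls_sequence ::
  "('a::real_inner \<Rightarrow> real) \<Rightarrow> ('a \<Rightarrow> ereal) \<Rightarrow> nat \<Rightarrow> real \<Rightarrow> real \<Rightarrow> real \<Rightarrow> real \<Rightarrow> real \<Rightarrow>
    real \<Rightarrow> real \<Rightarrow> (nat \<Rightarrow> 'a) \<Rightarrow> bool" where
  "pgenls_sequence f g m \<delta> \<alpha> \<tau>min \<tau>max \<beta>max \<eta>1 \<eta>2 x \<longleftrightarrow>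
     x 0 \<in> domain_of g \<and> (\<forall>k. pgenls_step f g m \<delta> \<alpha> \<tau>min \<tau>max \<beta>max \<eta>1 \<eta>2 x k)"

definition ell :: "('a \<times> 'a \<Rightarrow> ereal) \<Rightarrow> nat \<Rightarrow> (nat \<Rightarrow> 'a) \<Rightarrow> nat \<Rightarrow> nat" where
  "ell H m x k = Max {j. is_arg_max (\<lambda>j. H (zpair x j)) (\<lambda>j. j \<in> {k - m..k}) j}"

end

theory Submission
  imports Defs
begin

text \<open>Comparing the proximal point \<open>x\<^sup>k\<^sup>+\<^sup>1\<close> with \<open>x\<^sup>k\<close> bounds the increase of the potential in one
  step by a quantity that vanishes with the step length. Hence the values of the potential cannot
  drop far below the limit of the window maxima, so the whole sequence of values converges to that
  limit and the step lengths tend to zero. Comparing the proximal points with the limit \<open>xh\<close> instead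
  bounds the limit of the values by the value at \<open>(xh, xh)\<close>. The subgradient is the gradient of the
  smooth part minus the residual of the proximal step; since the proximal objective gives a quadratic
  minorant of \<open>g\<close>, it is even a regular subgradient.\<close>

subsection \<open>Nonmonotone descent of real sequences\<close>

lemma Max_window_le:
  fixes h :: "nat \<Rightarrow> real"
  assumes "\<And>j. k - m \<le> j \<Longrightarrow> j \<le> k \<Longrightarrow> h j \<le> c"
  shows "Max (h ` {k - m..k}) \<le> c"
  using assms by auto

text \<open>Shifting the window by one index adds only \<open>h (Suc k)\<close>, which the old
  maximum already bounds; every other entry was in the old window.\<close>

lemma decseq_Max_window:
  fixes h :: "nat \<Rightarrow> real"
  assumes "\<And>k. h (Suc k) \<le> Max (h ` {k - m..k})"
  shows "decseq (\<lambda>k. Max (h ` {k - m..k}))"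
proof (rule decseq_SucI, rule Max_window_le)
  fix k j assume "Suc k - m \<le> j" "j \<le> Suc k"
  then show "h j \<le> Max (h ` {k - m..k})"
    using assms[of k] by (cases "j = Suc k") auto
qed

text \<open>The first window is \<open>{0}\<close>, so its maximum is \<open>h 0\<close>, and the
  window maxima never rise above it. This later keeps the iterates in one sublevel set.\<close>

lemma nonmonotone_descent_le_initial:
  fixes h :: "nat \<Rightarrow> real"
  assumes "\<And>k. h (Suc k) \<le> Max (h ` {k - m..k})"
  shows "h k \<le> h 0"
proof -
  have "h k \<le> Max (h ` {k - m..k})"
    by simp
  also have "\<dots> \<le> Max (h ` {0 - m..0})"
    using decseq_Max_window[OF assms] unfolding decseq_def by blast
  finally show ?thesis
    by simp
qed

text \<open>An index whose value is close to the limit of the window maxima passes this property on to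
  its predecessor, and every index is reached from a maximizing one in at most \<open>m\<close> such steps.\<close>

lemma nonmonotone_descent_convergence:
  fixes h d :: "nat \<Rightarrow> real"
  assumes c: "0 < c"
    and descent: "\<And>k. h (Suc k) \<le> Max (h ` {k - m..k}) - c * (d k)\<^sup>2"
    and lower: "\<And>k. b \<le> h k"
    and increase: "\<And>k. h (Suc k) \<le> h k + a\<^sub>1 * d k + a\<^sub>2 * (d k)\<^sup>2"
  obtains M where "(\<lambda>k. Max (h ` {k - m..k})) \<longlonglongrightarrow> M" and "h \<longlonglongrightarrow> M" and "d \<longlonglongrightarrow> 0"
proof -
  define W where "W k = Max (h ` {k - m..k})" for k
  have desc: "h (Suc k) \<le> W k - c * (d k)\<^sup>2" for k
    using descent by (simp add: W_def)
  have hW: "h k \<le> W k" for k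
    by (simp add: W_def)
  have "0 \<le> c * (d k)\<^sup>2" for k
    using c by simp
  then have "h (Suc k) \<le> W k" for k
    using desc[of k] by (metis diff_left_mono diff_zero order_trans)
  then have "decseq W"
    unfolding W_def by (rule decseq_Max_window)
  moreover have "b \<le> W k" for k
    using lower[of k] hW[of k] by linarith
  ultimately obtain M where WM: "W \<longlonglongrightarrow> M"
    by (metis decseq_convergent)
  \<comment> \<open>Along any index sequence on which the next values tend to \<open>M\<close>, the
    descent inequality squeezes \<open>(d (s k))\<^sup>2\<close> between 0 and
    \<open>(W (s k) - h (Suc (s k))) / c\<close>, whose numerator tends to
    \<open>M - M\<close>.\<close>
  have d0: "(\<lambda>k. d (s k)) \<longlonglongrightarrow> 0"
    if s: "filterlim s at_top sequentially" and hs: "(\<lambda>k. h (Suc (s k))) \<longlonglongrightarrow> M" for s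
  proof -
    have Ws: "(\<lambda>k. W (s k)) \<longlonglongrightarrow> M"
      using filterlim_compose[OF WM s] .
    have "(\<lambda>k. (W (s k) - h (Suc (s k))) / c) \<longlonglongrightarrow> (M - M) / c"
      by (intro tendsto_intros Ws hs) (use c in simp)
    then have "(\<lambda>k. (W (s k) - h (Suc (s k))) / c) \<longlonglongrightarrow> 0"
      by simp
    then have "(\<lambda>k. (d (s k))\<^sup>2) \<longlonglongrightarrow> 0"
    proof (rule tendsto_sandwich[OF _ _ tendsto_const, rotated 2])
      have "(d (s k))\<^sup>2 \<le> (W (s k) - h (Suc (s k))) / c" for k
        using desc[of "s k"] c by (simp add: pos_le_divide_eq mult.commute)
      then show "\<forall>\<^sub>F k in sequentially. (d (s k))\<^sup>2 \<le> (W (s k) - h (Suc (s k))) / c"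
        by simp
    qed simp
    then show ?thesis
      by (simp add: power_tendsto_0_iff)
  qed
  \<comment> \<open>The increase bound is read backwards, as a lower bound for
    \<open>h (s k)\<close> in terms of its successor; the window maximum is the upper bound.\<close>
  have pred: "(\<lambda>k. h (s k)) \<longlonglongrightarrow> M"
    if s: "filterlim s at_top sequentially" and hs: "(\<lambda>k. h (Suc (s k))) \<longlonglongrightarrow> M" for s
  proof (rule tendsto_sandwich)
    have "(\<lambda>k. h (Suc (s k)) - a\<^sub>1 * d (s k) - a\<^sub>2 * (d (s k))\<^sup>2) \<longlonglongrightarrow> M - a\<^sub>1 * 0 - a\<^sub>2 * 0\<^sup>2"
      by (intro tendsto_intros d0[OF s hs] hs)
    then show "(\<lambda>k. h (Suc (s k)) - a\<^sub>1 * d (s k) - a\<^sub>2 * (d (s k))\<^sup>2) \<longlonglongrightarrow> M"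
      by simp
    have "h (Suc (s k)) - a\<^sub>1 * d (s k) - a\<^sub>2 * (d (s k))\<^sup>2 \<le> h (s k)" for k
      using increase[of "s k"] by linarith
    then show "\<forall>\<^sub>F k in sequentially. h (Suc (s k)) - a\<^sub>1 * d (s k) - a\<^sub>2 * (d (s k))\<^sup>2 \<le> h (s k)"
      by simp
    show "\<forall>\<^sub>F k in sequentially. h (s k) \<le> W (s k)"
      using hW by simp
    show "(\<lambda>k. W (s k)) \<longlonglongrightarrow> M"
      using filterlim_compose[OF WM s] .
  qed
  have "\<exists>j. j \<in> {k - m..k} \<and> h j = W k" for k
  proof -
    have "W k \<in> h ` {k - m..k}"
      unfolding W_def by (rule Max_in) auto
    then show ?thesis by auto
  qed
  then obtain l where l: "\<And>k. l k \<in> {k - m..k}" "\<And>k. h (l k) = W k"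
    by metis
  have l_top: "filterlim (\<lambda>k. l k - j) at_top sequentially" for j
  proof (rule filterlim_at_top_mono)
    show "filterlim (\<lambda>k. k - (m + j)) at_top sequentially"
      by (rule filterlim_minus_const_nat_at_top)
    have "k - (m + j) \<le> l k - j" for k
      using l(1)[of k] by auto
    then show "\<forall>\<^sub>F k in sequentially. k - (m + j) \<le> l k - j"
      by simp
  qed
  have back_lim: "(\<lambda>k. h (l k - j)) \<longlonglongrightarrow> M" for j
  proof (induction j)
    case 0
    then show ?case using WM by (simp add: l(2))
  next
    case (Suc j)
    \<comment> \<open>The rewriting of \<open>l k - j\<close> as \<open>Suc (l k - Suc j)\<close>
      fails where the subtraction truncates, which happens for finitely many \<open>k\<close>
      only.\<close>
    have "\<forall>\<^sub>F k in sequentially. Suc j \<le> l k"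
      using l_top[of 0] by (simp add: filterlim_at_top)
    then have "\<forall>\<^sub>F k in sequentially. h (l k - j) = h (Suc (l k - Suc j))"
      by eventually_elim (simp add: Suc_diff_Suc)
    then have "(\<lambda>k. h (Suc (l k - Suc j))) \<longlonglongrightarrow> M"
      using Suc by (rule Lim_transform_eventually[rotated])
    then show ?case
      by (rule pred[OF l_top])
  qed
  have hM: "h \<longlonglongrightarrow> M"
  proof (rule tendstoI)
    fix e :: real assume "0 < e"
    then have "\<forall>\<^sub>F k in sequentially. \<forall>j\<in>{..m}. dist (h (l k - j)) M < e"
      using back_lim by (intro eventually_ball_finite ballI tendstoD) auto
    \<comment> \<open>The window of \<open>n + m\<close> is \<open>{n..n + m}\<close>, so
      \<open>n\<close> lies at most \<open>m\<close> places before \<open>l (n + m)\<close>.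
      Finitely many offsets \<open>j\<close> make the estimate uniform, hence valid at every large
      \<open>n\<close>.\<close>
    then have "\<forall>\<^sub>F n in sequentially. \<forall>j\<in>{..m}. dist (h (l (n + m) - j)) M < e"
      by (rule eventually_compose_filterlim[OF _ filterlim_add_const_nat_at_top])
    then show "\<forall>\<^sub>F n in sequentially. dist (h n) M < e"
    proof eventually_elim
      case (elim n)
      have "l (n + m) - n \<in> {..m}" "l (n + m) - (l (n + m) - n) = n"
        using l(1)[of "n + m"] by auto
      then show ?case
        using elim by metis
    qed
  qed
  have "d \<longlonglongrightarrow> 0"
    using d0[OF filterlim_ident] LIMSEQ_Suc[OF hM] by simp
  with WM hM show thesis
    by (intro that) (simp_all add: W_def[abs_def])
qed

subsection \<open>Smooth functions, proximal points and subgradients\<close>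

text \<open>Mean value inequality on the segment from \<open>a\<close> to \<open>b\<close>, where
  the gradient differs from that at \<open>a\<close> by at most \<open>L * norm (b - a)\<close>. A
  two-sided first-order bound suffices, since the increment only has to vanish with the step
  length.\<close>

lemma smooth_fun_increment_le:
  assumes "smooth_fun L f"
  shows "f b - f a \<le> (norm (gradient f a) + L * norm (b - a)) * norm (b - a)"
proof -
  have L: "L-lipschitz_on UNIV (gradient f)"
    and D: "\<And>x. (f has_derivative (\<lambda>h. h \<bullet> gradient f x)) (at x)"
    using assms by (auto simp: smooth_fun_def gderiv_def)
  have "norm (f b - f a) \<le> (norm (gradient f a) + L * norm (b - a)) * norm (b - a)"
  proof (rule differentiable_bound[where S = "closed_segment a b" and f' = "\<lambda>x h. h \<bullet> gradient f x"])
    fix u assume u: "u \<in> closed_segment a b"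
    have "norm (gradient f u) \<le> norm (gradient f a) + norm (gradient f u - gradient f a)"
      by (rule norm_triangle_sub)
    also have "norm (gradient f u - gradient f a) \<le> L * norm (u - a)"
      using lipschitz_onD[OF L, of u a] by (simp add: dist_norm)
    also have "L * norm (u - a) \<le> L * norm (b - a)"
      using segment_bound(1)[OF u] lipschitz_on_nonneg[OF L] by (intro mult_left_mono)
    finally have "norm (gradient f u) \<le> norm (gradient f a) + L * norm (b - a)"
      by simp
    moreover have "onorm (\<lambda>h. h \<bullet> gradient f u) \<le> norm (gradient f u)"
      by (rule onorm_bound) (use Cauchy_Schwarz_ineq2 in \<open>simp_all add: mult.commute\<close>)
    ultimately show "onorm (\<lambda>h. h \<bullet> gradient f u) \<le> norm (gradient f a) + L * norm (b - a)"
      by linarith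
  qed (auto intro: D[THEN has_derivative_at_withinI])
  then show ?thesis
    by simp
qed

lemma prox_le:
  assumes "p \<in> prox \<tau> g c"
  shows "ereal (1 / (2 * \<tau>) * (norm (p - c))\<^sup>2) + g p \<le> ereal (1 / (2 * \<tau>) * (norm (z - c))\<^sup>2) + g z"
  using assms by (auto simp: prox_def is_arg_min_def not_less)

lemma prox_finite:
  assumes "p \<in> prox \<tau> g c" and "proper_fun g"
  shows "\<bar>g p\<bar> \<noteq> \<infinity>"
proof -
  obtain z where "g z < \<infinity>"
    using assms by (auto simp: proper_fun_def)
  then have "ereal (1 / (2 * \<tau>) * (norm (z - c))\<^sup>2) + g z < \<infinity>"
    by auto
  with prox_le[OF assms(1), of z] have "g p \<noteq> \<infinity>"
    by auto
  with assms(2) show ?thesis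
    by (auto simp: proper_fun_def)
qed

text \<open>Expanding the squared distance to \<open>c\<close> around \<open>p\<close> turns
  minimality of \<open>p\<close> into a concave (for positive \<tau>) quadratic that touches
  \<open>g\<close> from below at \<open>p\<close>. Its slope there is the residual of the proximal
  step; convexity of \<open>g\<close> is not involved.\<close>

lemma prox_quadratic_minorant:
  fixes p c :: "'a::real_inner"
  assumes "p \<in> prox \<tau> g c" and "proper_fun g"
  shows "g p + ereal (- (1 / \<tau>) * ((p - c) \<bullet> (z - p)) - 1 / (2 * \<tau>) * (norm (z - p))\<^sup>2) \<le> g z"
proof -
  obtain r where r: "g p = ereal r"
    using prox_finite[OF assms] by auto
  have "g z \<noteq> -\<infinity>"
    using assms by (auto simp: proper_fun_def)
  moreover have "(norm (z - c))\<^sup>2 = (norm (p - c))\<^sup>2 + 2 * ((p - c) \<bullet> (z - p)) + (norm (z - p))\<^sup>2"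
    using dot_norm[of "p - c" "z - p"] by simp
  then have "1 / (2 * \<tau>) * (norm (p - c))\<^sup>2 - 1 / (2 * \<tau>) * (norm (z - c))\<^sup>2
      = - (1 / \<tau>) * ((p - c) \<bullet> (z - p)) - 1 / (2 * \<tau>) * (norm (z - p))\<^sup>2"
    \<comment> \<open>No sign of \<tau> is assumed; for \<open>\<tau> = 0\<close> all terms vanish
      because division by zero gives 0.\<close>
    by (cases "\<tau> = 0") (simp_all add: field_simps)
  ultimately show ?thesis
    using prox_le[OF assms(1), of z] r by (cases "g z") auto
qed

text \<open>After expansion the terms \<open>(norm (\<tau> *\<^sub>R v))\<^sup>2\<close> cancel, the
  cross terms combine to \<open>v \<bullet> (z - p)\<close>, and the nonnegative term in
  \<open>p - y\<close> is dropped. Replacing \<tau> by \<tau>min makes the constant uniform over all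
  iterations.\<close>

lemma prox_gradient_step_le:
  fixes y v :: "'a::real_inner"
  assumes "p \<in> prox \<tau> g (y - \<tau> *\<^sub>R v)" and "proper_fun g" and "0 < \<tau>min" "\<tau>min \<le> \<tau>"
  shows "g p \<le> g z + ereal (1 / (2 * \<tau>min) * (norm (z - y))\<^sup>2 + norm v * norm (z - p))"
proof -
  obtain r where r: "g p = ereal r"
    using prox_finite[OF assms(1,2)] by auto
  have \<tau>: "0 < \<tau>"
    using assms by simp
  have nonneg: "0 \<le> 1 / (2 * \<tau>) * (norm (p - y))\<^sup>2"
    using \<tau> by simp
  have sq: "(norm (w - (y - \<tau> *\<^sub>R v)))\<^sup>2 = (norm (w - y))\<^sup>2 + 2 * \<tau> * (v \<bullet> (w - y)) + (norm (\<tau> *\<^sub>R v))\<^sup>2" for w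
    using dot_norm[of "w - y" "\<tau> *\<^sub>R v"] by (simp add: inner_commute algebra_simps)
  have "1 / (2 * \<tau>) * (norm (z - (y - \<tau> *\<^sub>R v)))\<^sup>2 - 1 / (2 * \<tau>) * (norm (p - (y - \<tau> *\<^sub>R v)))\<^sup>2
      = 1 / (2 * \<tau>) * (norm (z - y))\<^sup>2 - 1 / (2 * \<tau>) * (norm (p - y))\<^sup>2 + (v \<bullet> (z - y) - v \<bullet> (p - y))"
    unfolding sq using \<tau> by (simp add: field_simps)
  also have "v \<bullet> (z - y) - v \<bullet> (p - y) = v \<bullet> (z - p)"
    by (simp add: inner_diff_right)
  also have "1 / (2 * \<tau>) * (norm (z - y))\<^sup>2 - 1 / (2 * \<tau>) * (norm (p - y))\<^sup>2 + v \<bullet> (z - p)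
      \<le> 1 / (2 * \<tau>) * (norm (z - y))\<^sup>2 + norm v * norm (z - p)"
    using nonneg norm_cauchy_schwarz[of v "z - p"] by linarith
  also have "1 / (2 * \<tau>) * (norm (z - y))\<^sup>2 \<le> 1 / (2 * \<tau>min) * (norm (z - y))\<^sup>2"
    using assms by (intro mult_right_mono divide_left_mono) auto
  finally have *: "1 / (2 * \<tau>) * (norm (z - (y - \<tau> *\<^sub>R v)))\<^sup>2 - 1 / (2 * \<tau>) * (norm (p - (y - \<tau> *\<^sub>R v)))\<^sup>2
      \<le> 1 / (2 * \<tau>min) * (norm (z - y))\<^sup>2 + norm v * norm (z - p)"
    by simp
  have "g z \<noteq> -\<infinity>"
    using assms by (auto simp: proper_fun_def)
  then show ?thesis
    using prox_le[OF assms(1), of z] r * by (cases "g z") auto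
qed

text \<open>Clears the extended-real difference quotient once and for all. The inequality is trivial
  at \<open>y = x\<close>, so the full neighbourhood filter \<open>nhds x\<close> is as good as the
  punctured one.\<close>

lemma regular_subdiffI:
  fixes v x :: "'a::real_inner"
  assumes "\<bar>h x\<bar> \<noteq> \<infinity>"
    and "\<And>e. 0 < e \<Longrightarrow> \<forall>\<^sub>F y in nhds x. h x + ereal (v \<bullet> (y - x) - e * norm (y - x)) \<le> h y"
  shows "v \<in> regular_subdiff h x"
proof -
  obtain r where r: "h x = ereal r"
    using assms by auto
  let ?q = "\<lambda>y. (h y - h x - ereal (v \<bullet> (y - x))) / ereal (norm (y - x))"
  have Liminf_ge: "ereal (- e) \<le> Liminf (at x) ?q" if "0 < e" for e :: real
  proof (rule Liminf_bounded)
    show "\<forall>\<^sub>F y in at x. ereal (- e) \<le> ?q y"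
      using assms(2)[OF that] unfolding eventually_at_filter
    proof eventually_elim
      case (elim y)
      show ?case
      proof (intro impI)
        assume "y \<noteq> x"
        then have "0 < norm (y - x)"
          by simp
        with elim r show "ereal (- e) \<le> ?q y"
          by (cases "h y") (simp_all add: pos_le_divide_eq)
      qed
    qed
  qed
  have "0 \<le> Liminf (at x) ?q"
  proof (rule ereal_le_epsilon2)
    fix e :: real assume "0 < e"
    have "0 = ereal (- e) + ereal e"
      by simp
    also have "\<dots> \<le> Liminf (at x) ?q + ereal e"
      by (rule add_right_mono[OF Liminf_ge[OF \<open>0 < e\<close>]])
    finally show "0 \<le> Liminf (at x) ?q + ereal e" .
  qed
  with assms(1) show ?thesis
    by (simp add: regular_subdiff_def)
qed

lemma regular_subdiff_subset_limiting: "regular_subdiff h x \<subseteq> limiting_subdiff h x"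
proof
  fix v assume "v \<in> regular_subdiff h x"
  then show "v \<in> limiting_subdiff h x"
    unfolding limiting_subdiff_def mem_Collect_eq
    by (intro conjI exI[of _ "\<lambda>_. x"] exI[of _ "\<lambda>_. v"]) (auto simp: regular_subdiff_def)
qed

text \<open>Three minorants at \<open>(p, u)\<close> are added: the first-order expansion of
  \<open>f\<close> up to a small error, the quadratic minorant of \<open>g\<close>, and the tangent
  of the convex coupling term. The total error is at most \<open>e\<close> times the
  distance.\<close>

lemma potential_subgradient:
  fixes p c u :: "'a::real_inner"
  assumes f: "smooth_fun L f" and g: "proper_fun g" and p: "p \<in> prox \<tau> g c"
    and \<tau>: "0 < \<tau>" and \<delta>: "0 \<le> \<delta>"
  shows "(gradient f p - (1 / \<tau>) *\<^sub>R (p - c) + \<delta> *\<^sub>R (p - u), - \<delta> *\<^sub>R (p - u))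
    \<in> regular_subdiff (potential (objective f g) \<delta>) (p, u)" (is "?w \<in> regular_subdiff ?H _")
proof (rule regular_subdiffI)
  obtain r where r: "g p = ereal r"
    using prox_finite[OF p g] by auto
  then show "\<bar>?H (p, u)\<bar> \<noteq> \<infinity>"
    by (simp add: potential_def objective_def)
  fix e :: real assume e: "0 < e"
  have "(f has_derivative (\<lambda>h. h \<bullet> gradient f p)) (at p)"
    using f by (auto simp: smooth_fun_def gderiv_def)
  then obtain s where s: "0 < s"
    "\<And>z. norm (z - p) < s \<Longrightarrow> norm (f z - f p - (z - p) \<bullet> gradient f p) \<le> e / 2 * norm (z - p)"
    using e unfolding has_derivative_at_alt by (meson half_gt_zero)
  \<comment> \<open>The error budget is split in halves: radius \<open>s\<close> keeps the error of
    \<open>f\<close> below \<open>e / 2 * norm (a - p)\<close>, and radius \<open>e * \<tau>\<close>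
    does the same for the quadratic error of \<open>g\<close>.\<close>
  define s' where "s' = min s (e * \<tau>)"
  have "0 < s'"
    using s e \<tau> by (simp add: s'_def)
  then have "\<forall>\<^sub>F y in nhds (p, u). dist y (p, u) < s'"
    by (auto simp: eventually_nhds_metric)
  then show "\<forall>\<^sub>F y in nhds (p, u). ?H (p, u) + ereal (?w \<bullet> (y - (p, u)) - e * norm (y - (p, u))) \<le> ?H y"
  proof eventually_elim
    case (elim y)
    obtain a b where y: "y = (a, b)"
      by force
    define N where "N = norm (y - (p, u))"
    have aN: "norm (a - p) \<le> N"
      unfolding N_def y using norm_fst_le[of "a - p" "b - u"] by simp
    with elim have "norm (a - p) < s" and a2: "norm (a - p) \<le> e * \<tau>"
      by (auto simp: N_def s'_def dist_norm)
    then have fa: "f p + (a - p) \<bullet> gradient f p - e / 2 * norm (a - p) \<le> f a"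
      using s(2)[of a] unfolding real_norm_def by linarith
    have "1 / (2 * \<tau>) * (norm (a - p))\<^sup>2 \<le> 1 / (2 * \<tau>) * ((e * \<tau>) * norm (a - p))"
      unfolding power2_eq_square using \<tau> a2 by (intro mult_left_mono mult_right_mono) auto
    then have quad: "1 / (2 * \<tau>) * (norm (a - p))\<^sup>2 \<le> e / 2 * norm (a - p)"
      using \<tau> by simp
    \<comment> \<open>Convexity of the coupling term: its linearization error is a square, so this
      term uses none of \<open>e\<close>.\<close>
    have "(norm (a - b))\<^sup>2 = (norm (p - u))\<^sup>2 + 2 * ((p - u) \<bullet> ((a - p) - (b - u))) + (norm ((a - p) - (b - u)))\<^sup>2"
      using dot_norm[of "p - u" "(a - p) - (b - u)"] by simp
    then have "(norm (a - b))\<^sup>2 - (norm (p - u))\<^sup>2 - 2 * ((p - u) \<bullet> (a - p) - (p - u) \<bullet> (b - u))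
        = (norm ((a - p) - (b - u)))\<^sup>2"
      unfolding inner_diff_right[of "p - u" "a - p"] by simp
    then have "0 \<le> (norm (a - b))\<^sup>2 - (norm (p - u))\<^sup>2 - 2 * ((p - u) \<bullet> (a - p) - (p - u) \<bullet> (b - u))"
      by simp
    then have "0 \<le> \<delta> / 2 * ((norm (a - b))\<^sup>2 - (norm (p - u))\<^sup>2 - 2 * ((p - u) \<bullet> (a - p) - (p - u) \<bullet> (b - u)))"
      using \<delta> by simp
    then have sq: "\<delta> / 2 * (norm (p - u))\<^sup>2 + \<delta> * ((p - u) \<bullet> (a - p)) - \<delta> * ((p - u) \<bullet> (b - u))
        \<le> \<delta> / 2 * (norm (a - b))\<^sup>2"
      by (simp add: algebra_simps)
    have eN: "e * norm (a - p) \<le> e * N"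
      using aN e by simp
    have w: "?w \<bullet> (y - (p, u)) = (a - p) \<bullet> gradient f p - (1 / \<tau>) * ((p - c) \<bullet> (a - p))
        + \<delta> * ((p - u) \<bullet> (a - p)) - \<delta> * ((p - u) \<bullet> (b - u))"
      unfolding y diff_Pair inner_Pair inner_add_left inner_diff_left[of "gradient f p"]
      by (simp add: inner_commute[of "gradient f p"])
    show ?case
      using prox_quadratic_minorant[OF p g, of a] fa quad sq eN w r
      unfolding N_def[symmetric]
      by (cases "g a") (auto simp: potential_def objective_def y)
  qed
qed

section \<open>Accepted steps of the algorithm and window maximizers\<close>

text \<open>Extracts the accepted pass. Powers of \<open>\<eta>1\<close> are at most 1, so the bound
  \<beta>max survives backtracking, and the truncation by \<open>max\<close> keeps \<tau> above
  \<tau>min.\<close>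

lemma pgenls_stepE:
  assumes "pgenls_step f g m \<delta> \<alpha> \<tau>min \<tau>max \<beta>max \<eta>1 \<eta>2 x k" and "0 \<le> \<eta>1" "\<eta>1 \<le> 1"
  obtains \<beta> \<tau> y where "0 \<le> \<beta>" "\<beta> \<le> \<beta>max" "\<tau>min \<le> \<tau>" "y = x k + \<beta> *\<^sub>R (x k - x (k - 1))"
    and "x (Suc k) \<in> prox \<tau> g (y - \<tau> *\<^sub>R gradient f y)"
    and "accepts (potential (objective f g) \<delta>) m \<alpha> x k (x (Suc k))"
proof -
  obtain \<beta>0 \<tau>0 p N where b: "\<beta>0 \<in> {0..\<beta>max}"
    and p: "\<And>l. l \<le> N \<Longrightarrow>
           let \<beta> = \<beta>0 * \<eta>1 ^ l;
               \<tau> = max (\<tau>0 * \<eta>2 ^ l) \<tau>min;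
               y = x k + \<beta> *\<^sub>R (x k - x (k - 1))
           in p l \<in> prox \<tau> g (y - \<tau> *\<^sub>R gradient f y)"
    and a: "accepts (potential (objective f g) \<delta>) m \<alpha> x k (p N)" "x (Suc k) = p N"
    using assms(1) unfolding pgenls_step_def by blast
  have "\<beta>0 * \<eta>1 ^ N \<le> \<beta>0 * 1"
    using b assms by (intro mult_left_mono power_le_one) auto
  then show thesis
    using p[of N] a b assms by (intro that[of "\<beta>0 * \<eta>1 ^ N" "max (\<tau>0 * \<eta>2 ^ N) \<tau>min"]) (auto simp: Let_def)
qed

text \<open>The set of maximizers in the window is finite and nonempty, so the \<open>Max\<close>
  defining \<open>ell\<close> belongs to it.\<close>

lemma ell_attains_Max:
  fixes H :: "'a \<times> 'a \<Rightarrow> ereal"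
  shows "H (zpair x (ell H m x k)) = (MAX j\<in>{k - m..k}. H (zpair x j))"
proof -
  let ?A = "{j. is_arg_max (\<lambda>j. H (zpair x j)) (\<lambda>j. j \<in> {k - m..k}) j}"
  have "(MAX j\<in>{k - m..k}. H (zpair x j)) \<in> (\<lambda>j. H (zpair x j)) ` {k - m..k}"
    by (rule Max_in) auto
  then obtain j where "j \<in> {k - m..k}" "H (zpair x j) = (MAX j\<in>{k - m..k}. H (zpair x j))"
    by force
  then have "j \<in> ?A"
    by (auto simp: is_arg_max_linorder)
  moreover have "finite ?A"
    by (rule finite_subset[of _ "{k - m..k}"]) (auto simp: is_arg_max_def)
  ultimately have "ell H m x k \<in> ?A"
    unfolding ell_def by (intro Max_in) auto
  then show ?thesis
    by (intro Max_eqI[symmetric]) (auto simp: is_arg_max_linorder)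
qed

theorem lemma4p3:
  fixes f :: "'a::real_inner \<Rightarrow> real"
    and g :: "'a \<Rightarrow> ereal"
    and L \<delta> \<alpha> \<tau>min \<tau>max \<beta>max \<eta>1 \<eta>2 :: real
    and m :: nat
    and x :: "nat \<Rightarrow> 'a"
  assumes "finite_dim TYPE('a)"
    and "smooth_fun L f"
    and "proper_fun g" and "lower_semicont g" and "bounded_below_fun g"
    and "coercive (objective f g)" and "bounded_below_fun (objective f g)"
    and "0 < \<delta>" and "\<delta> < 1 / 2"
    and "0 < \<alpha>" and "\<alpha> < \<delta> / 2"
    and "0 < \<tau>min" and "\<tau>min \<le> 1 / (2 * (\<alpha> + \<delta>) + L)" and "1 / (2 * (\<alpha> + \<delta>) + L) < \<tau>max"
    and "0 \<le> \<beta>max"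
    and "0 < \<eta>1" and "\<eta>1 < 1" and "0 < \<eta>2" and "\<eta>2 < 1"
    and "pgenls_sequence f g m \<delta> \<alpha> \<tau>min \<tau>max \<beta>max \<eta>1 \<eta>2 x"
  shows
    "let H = potential (objective f g) \<delta>; z = zpair x; \<l> = ell H m x in
       (convergent (\<lambda>k. H (z (\<l> k))) \<and>
        liminf (\<lambda>k. H (z k)) \<ge> lim (\<lambda>k. H (z (\<l> k)))) \<and>
       (\<forall>\<kappa> xh. strict_mono \<kappa> \<longrightarrow> (\<lambda>q. x (\<kappa> q)) \<longlonglongrightarrow> xh \<longrightarrow>
          limsup (\<lambda>q. H (z (\<kappa> q))) \<le> H (xh, xh)) \<and>
       (\<forall>k\<ge>1. \<exists>w \<in> limiting_subdiff H (z k).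
          norm w \<le> sqrt 2 * ((L + inverse \<tau>min) * (1 + \<beta>max) + 2 * \<delta>) * norm (z k - z (k - 1)))"
proof -
  note f = assms(2) and g = assms(3) and lowerF = assms(7) and coerc = assms(6)
    and \<delta> = assms(8) and \<alpha> = assms(10) and \<tau>min = assms(12) and \<beta>max = assms(15)
  define H where "H = potential (objective f g) \<delta>"
  have lip: "L-lipschitz_on UNIV (gradient f)"
    using f by (simp add: smooth_fun_def)
  then have L: "0 \<le> L"
    by (rule lipschitz_on_nonneg)
  have grad_lip: "norm (gradient f u - gradient f v) \<le> L * norm (u - v)" for u v
    using lipschitz_onD[OF lip, of u v] by (simp add: dist_norm)
  have f_cont: "isCont f u" for u
    using f by (auto simp: smooth_fun_def gderiv_def intro: has_derivative_continuous)
  have x0: "x 0 \<in> domain_of g"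
    and steps: "\<And>k. pgenls_step f g m \<delta> \<alpha> \<tau>min \<tau>max \<beta>max \<eta>1 \<eta>2 x k"
    using assms(20) by (auto simp: pgenls_sequence_def)
  \<comment> \<open>Bundling all facts on the accepted pass in one predicate lets the parameters of
    all iterations be chosen simultaneously as sequences.\<close>
  define P where "P k \<beta> \<tau> y \<longleftrightarrow> 0 \<le> \<beta> \<and> \<beta> \<le> \<beta>max \<and> \<tau>min \<le> \<tau> \<and> y = x k + \<beta> *\<^sub>R (x k - x (k - 1)) \<and>
      x (Suc k) \<in> prox \<tau> g (y - \<tau> *\<^sub>R gradient f y) \<and> accepts H m \<alpha> x k (x (Suc k))" for k \<beta> \<tau> y
  have "\<exists>\<beta> \<tau> y. P k \<beta> \<tau> y" for k
    by (rule pgenls_stepE[OF steps[of k]]) (use assms(16,17) in \<open>auto simp: H_def P_def\<close>)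
  then obtain \<beta> \<tau> y where "\<And>k. P k (\<beta> k) (\<tau> k) (y k)"
    by metis
  then have \<beta>: "\<And>k. 0 \<le> \<beta> k" "\<And>k. \<beta> k \<le> \<beta>max" and \<tau>: "\<And>k. \<tau>min \<le> \<tau> k"
    and y: "\<And>k. y k = x k + \<beta> k *\<^sub>R (x k - x (k - 1))"
    and prox: "\<And>k. x (Suc k) \<in> prox (\<tau> k) g (y k - \<tau> k *\<^sub>R gradient f (y k))"
    and acc: "\<And>k. accepts H m \<alpha> x k (x (Suc k))"
    unfolding P_def by blast+

  \<comment> \<open>Real values of the potential along the iterates\<close>
  define r where "r k = real_of_ereal (g (x k))" for k
  have r: "g (x k) = ereal (r k)" for k
  proof -
    have "\<bar>g (x k)\<bar> \<noteq> \<infinity>"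
      \<comment> \<open>\<open>x 0\<close> lies in the domain of \<open>g\<close> by the choice of
        starting point; every later iterate is a proximal point.\<close>
      using x0 g prox_finite[OF prox g] by (cases k) (auto simp: domain_of_def proper_fun_def)
    then show ?thesis
      by (auto simp: r_def ereal_real)
  qed
  define h where "h k = f (x k) + r k + \<delta> / 2 * (norm (x k - x (k - 1)))\<^sup>2" for k
  have Hz: "H (zpair x k) = ereal (h k)" for k
    by (simp add: H_def potential_def objective_def zpair_def r h_def)
  define d where "d k = norm (zpair x (Suc k) - zpair x k)" for k
  have d: "0 \<le> d k" "norm (x (Suc k) - x k) \<le> d k" "norm (x k - x (k - 1)) \<le> d k" for k
    using norm_fst_le[of "x (Suc k) - x k" "x k - x (k - 1)"]
      norm_snd_le[of "x k - x (k - 1)" "x (Suc k) - x k"]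
    by (simp_all add: d_def zpair_def)
  have Max_H: "(MAX j\<in>{k - m..k}. H (zpair x j)) = ereal (Max (h ` {k - m..k}))" for k
    using mono_Max_commute[of ereal "h ` {k - m..k}"] by (simp add: Hz image_image mono_def)
  have descent: "h (Suc k) \<le> Max (h ` {k - m..k}) - \<alpha> / 2 * (d k)\<^sup>2" for k
  proof -
    have "zpair x (Suc k) = (x (Suc k), x k)"
      by (simp add: zpair_def)
    then show ?thesis
      using acc[of k] Hz[of "Suc k"] by (simp add: accepts_def Max_H d_def)
  qed
  have h_le: "h k \<le> h 0" for k
  proof (rule nonmonotone_descent_le_initial)
    have "0 \<le> \<alpha> / 2 * (d k)\<^sup>2" for k
      using \<alpha> by simp
    then show "h (Suc k) \<le> Max (h ` {k - m..k})" for k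
      using descent[of k] by (metis diff_left_mono diff_zero order_trans)
  qed
  have F_h: "objective f g (x k) \<le> ereal (h k)" for k
    using \<delta> by (simp add: objective_def r h_def)

  \<comment> \<open>Bounded iterates and uniform gradient bounds\<close>
  obtain b where "\<And>u. ereal b \<le> objective f g u"
    using lowerF by (auto simp: bounded_below_fun_def)
  then have h_lower: "b \<le> h k" for k
    using F_h[of k] by (metis ereal_less_eq(3) order_trans)
  \<comment> \<open>Outside a ball the objective exceeds \<open>h 0\<close>, while at the iterates
    it is at most \<open>h k\<close>, hence at most \<open>h 0\<close>.\<close>
  have "\<forall>\<^sub>F u in at_infinity. ereal (h 0) < objective f g u"
    using coerc by (simp add: coercive_def tendsto_PInfty)
  then obtain R where R: "\<And>u. R \<le> norm u \<Longrightarrow> ereal (h 0) < objective f g u"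
    by (auto simp: eventually_at_infinity)
  have x_le: "norm (x k) \<le> R" for k
  proof (rule ccontr)
    assume "\<not> norm (x k) \<le> R"
    then have "ereal (h 0) < objective f g (x k)"
      by (intro R) simp
    also have "\<dots> \<le> ereal (h k)"
      by (rule F_h)
    finally have "ereal (h 0) < ereal (h k)" .
    with h_le[of k] show False
      by simp
  qed
  have y_x: "norm (y k - x k) \<le> \<beta>max * norm (x k - x (k - 1))" for k
    using \<beta>[of k] by (simp add: y mult_right_mono)
  have y_x_d: "norm (y k - x k) \<le> \<beta>max * d k" for k
    using y_x[of k] mult_left_mono[OF d(3)[of k] \<beta>max] by linarith
  \<comment> \<open>Consecutive iterates are at most \<open>2 * R\<close> apart, so all
    \<open>x k\<close> and \<open>y k\<close> lie in the ball of radius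
    \<open>R + \<beta>max * (2 * R)\<close>; \<open>B\<close> bounds the gradient there.\<close>
  define B where "B = norm (gradient f 0) + L * (R + \<beta>max * (2 * R))"
  have R0: "0 \<le> R"
    using x_le[of 0] norm_ge_zero[of "x 0"] by linarith
  have grad_le: "norm (gradient f u) \<le> B" if "norm u \<le> R + \<beta>max * (2 * R)" for u
  proof -
    have "norm (gradient f u) \<le> norm (gradient f 0) + norm (gradient f u - gradient f 0)"
      by (rule norm_triangle_sub)
    also have "norm (gradient f u - gradient f 0) \<le> L * norm u"
      using grad_lip[of u 0] by simp
    also have "L * norm u \<le> L * (R + \<beta>max * (2 * R))"
      using that L by (rule mult_left_mono)
    finally show ?thesis
      by (simp add: B_def)
  qed
  have grad_x: "norm (gradient f (x k)) \<le> B" for k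
    using x_le[of k] mult_nonneg_nonneg[OF \<beta>max R0] by (intro grad_le) simp
  have grad_y: "norm (gradient f (y k)) \<le> B" for k
  proof (rule grad_le)
    have "norm (x k - x (k - 1)) \<le> 2 * R"
      using norm_triangle_ineq4[of "x k" "x (k - 1)"] x_le[of k] x_le[of "k - 1"] by linarith
    then have "norm (y k - x k) \<le> \<beta>max * (2 * R)"
      using y_x[of k] mult_left_mono[OF _ \<beta>max] by fastforce
    then show "norm (y k) \<le> R + \<beta>max * (2 * R)"
      using norm_triangle_sub[of "y k" "x k"] x_le[of k] by linarith
  qed
  have B: "0 \<le> B"
    using grad_x[of 0] norm_ge_zero order_trans by blast
  \<comment> \<open>Used with \<open>u = x k\<close> to bound the one-step increase, and with the
    limit point as \<open>u\<close> to bound the limit of the values.\<close>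
  have prox_r: "r (Suc k) \<le> s + 1 / (2 * \<tau>min) * (norm (u - y k))\<^sup>2 + B * norm (u - x (Suc k))"
    if "g u = ereal s" for u s k
  proof -
    have "r (Suc k) \<le> s + (1 / (2 * \<tau>min) * (norm (u - y k))\<^sup>2 + norm (gradient f (y k)) * norm (u - x (Suc k)))"
      using prox_gradient_step_le[OF prox g \<tau>min \<tau>, of k u] by (simp add: that r)
    also have "norm (gradient f (y k)) * norm (u - x (Suc k)) \<le> B * norm (u - x (Suc k))"
      by (intro mult_right_mono grad_y) simp
    finally show ?thesis
      by simp
  qed
  \<comment> \<open>\<open>2 * B\<close> collects the gradients at \<open>x k\<close> and
    \<open>y k\<close>, \<open>L\<close> the Lipschitz correction, the term with
    \<open>\<beta>max\<^sup>2\<close> the extrapolation distance, and \<open>\<delta> / 2\<close>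
    the new coupling term; the old coupling term only helps.\<close>
  have increase: "h (Suc k) \<le> h k + 2 * B * d k + (L + 1 / (2 * \<tau>min) * \<beta>max\<^sup>2 + \<delta> / 2) * (d k)\<^sup>2" for k
  proof -
    have "f (x (Suc k)) - f (x k) \<le> (norm (gradient f (x k)) + L * norm (x (Suc k) - x k)) * norm (x (Suc k) - x k)"
      by (rule smooth_fun_increment_le[OF f])
    also have "\<dots> \<le> (B + L * d k) * d k"
      by (intro mult_mono add_mono grad_x mult_left_mono d L add_nonneg_nonneg mult_nonneg_nonneg B) auto
    finally have 1: "f (x (Suc k)) - f (x k) \<le> (B + L * d k) * d k" .
    have "(norm (x k - y k))\<^sup>2 \<le> (\<beta>max * d k)\<^sup>2"
      using y_x_d[of k] by (intro power_mono) (simp_all add: norm_minus_commute)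
    then have "1 / (2 * \<tau>min) * (norm (x k - y k))\<^sup>2 \<le> 1 / (2 * \<tau>min) * (\<beta>max * d k)\<^sup>2"
      using \<tau>min by (intro mult_left_mono) auto
    moreover have "B * norm (x k - x (Suc k)) \<le> B * d k"
      using d(2)[of k] B by (intro mult_left_mono) (simp_all add: norm_minus_commute)
    ultimately have 2: "r (Suc k) \<le> r k + 1 / (2 * \<tau>min) * (\<beta>max * d k)\<^sup>2 + B * d k"
      using prox_r[OF r, of k k] by linarith
    have 3: "\<delta> / 2 * (norm (x (Suc k) - x k))\<^sup>2 \<le> \<delta> / 2 * (d k)\<^sup>2"
      using \<delta> d(2)[of k] by (intro mult_left_mono power_mono) auto
    have 4: "0 \<le> \<delta> / 2 * (norm (x k - x (k - 1)))\<^sup>2"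
      using \<delta> by simp
    have 5: "2 * B * d k + (L + 1 / (2 * \<tau>min) * \<beta>max\<^sup>2 + \<delta> / 2) * (d k)\<^sup>2
        = (B + L * d k) * d k + (1 / (2 * \<tau>min) * (\<beta>max * d k)\<^sup>2 + B * d k) + \<delta> / 2 * (d k)\<^sup>2"
      by (simp add: algebra_simps power2_eq_square)
    have "h (Suc k) = f (x (Suc k)) + r (Suc k) + \<delta> / 2 * (norm (x (Suc k) - x k))\<^sup>2"
      by (simp add: h_def)
    then show ?thesis
      using 1 2 3 4 5 h_def[of k] by linarith
  qed
  obtain M where W_lim: "(\<lambda>k. Max (h ` {k - m..k})) \<longlonglongrightarrow> M" and h_lim: "h \<longlonglongrightarrow> M" and d_lim: "d \<longlonglongrightarrow> 0"
    using nonmonotone_descent_convergence[of "\<alpha> / 2" h m d b, OF _ descent h_lower increase] \<alpha> by auto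

  \<comment> \<open>Convergence of the potential values\<close>
  have ell_lim: "(\<lambda>k. H (zpair x (ell H m x k))) \<longlonglongrightarrow> ereal M"
    using W_lim by (simp add: ell_attains_Max Max_H)
  have H_lim: "(\<lambda>k. H (zpair x k)) \<longlonglongrightarrow> ereal M"
    using h_lim by (simp add: Hz)
  have part1: "convergent (\<lambda>k. H (zpair x (ell H m x k)))"
      "lim (\<lambda>k. H (zpair x (ell H m x k))) \<le> liminf (\<lambda>k. H (zpair x k))"
    using ell_lim limI[OF ell_lim] lim_imp_Liminf[OF _ H_lim] by (auto simp: convergent_def)

  \<comment> \<open>Limit of the potential against its value at a cluster point\<close>
  have part2: "limsup (\<lambda>q. H (zpair x (\<kappa> q))) \<le> H (xh, xh)"
    if mono: "strict_mono \<kappa>" and lim: "(\<lambda>q. x (\<kappa> q)) \<longlonglongrightarrow> xh" for \<kappa> xh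
  proof (cases "g xh = \<infinity>")
    case True
    then show ?thesis
      by (simp add: H_def potential_def objective_def)
  next
    case False
    then obtain s where s: "g xh = ereal s"
      using g by (cases "g xh") (auto simp: proper_fun_def)
    have \<kappa>: "filterlim \<kappa> at_top sequentially"
      using mono by (rule filterlim_subseq)
    \<comment> \<open>\<open>x (\<kappa> q)\<close> is produced by the step with index
      \<open>\<kappa> q - 1\<close>; the truncated case \<open>\<kappa> q = 0\<close> is excluded
      eventually.\<close>
    have "filterlim (\<lambda>q. \<kappa> q - 1) at_top sequentially"
      using filterlim_compose[OF filterlim_minus_const_nat_at_top \<kappa>] .
    then have dk: "(\<lambda>q. d (\<kappa> q - 1)) \<longlonglongrightarrow> 0"
      by (rule filterlim_compose[OF d_lim])
    have pos: "\<forall>\<^sub>F q in sequentially. 1 \<le> \<kappa> q"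
      using \<kappa> by (simp add: filterlim_at_top)
    have "(\<lambda>q. y (\<kappa> q - 1) - x (\<kappa> q)) \<longlonglongrightarrow> 0"
    proof (rule Lim_null_comparison)
      have "(\<lambda>q. \<beta>max * d (\<kappa> q - 1) + d (\<kappa> q - 1)) \<longlonglongrightarrow> \<beta>max * 0 + 0"
        by (intro tendsto_intros dk)
      then show "(\<lambda>q. \<beta>max * d (\<kappa> q - 1) + d (\<kappa> q - 1)) \<longlonglongrightarrow> 0"
        by simp
      show "\<forall>\<^sub>F q in sequentially. norm (y (\<kappa> q - 1) - x (\<kappa> q)) \<le> \<beta>max * d (\<kappa> q - 1) + d (\<kappa> q - 1)"
        using pos
      proof eventually_elim
        case (elim q)
        then obtain n where n: "\<kappa> q = Suc n"
          by (cases "\<kappa> q") auto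
        have "norm (y n - x (Suc n)) \<le> norm (y n - x n) + norm (x (Suc n) - x n)"
          using norm_triangle_ineq4[of "y n - x n" "x (Suc n) - x n"] by simp
        then show ?case
          using y_x_d[of n] d(2)[of n] by (simp add: n)
      qed
    qed
    from tendsto_add[OF this lim] have y_lim: "(\<lambda>q. y (\<kappa> q - 1)) \<longlonglongrightarrow> xh"
      by simp
    \<comment> \<open>Upper bound from testing the proximal problem with \<open>xh\<close>:
      \<open>g\<close> enters only through the constant \<open>s\<close>, and every other term
      except the value of \<open>f\<close> vanishes in the limit.\<close>
    let ?u = "\<lambda>q. f (x (\<kappa> q)) + (s + 1 / (2 * \<tau>min) * (norm (xh - y (\<kappa> q - 1)))\<^sup>2
        + B * norm (xh - x (\<kappa> q))) + \<delta> / 2 * (d (\<kappa> q - 1))\<^sup>2"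
    have "?u \<longlonglongrightarrow> f xh + (s + 1 / (2 * \<tau>min) * (norm (xh - xh))\<^sup>2 + B * norm (xh - xh)) + \<delta> / 2 * 0\<^sup>2"
      by (intro tendsto_add tendsto_mult tendsto_power tendsto_norm tendsto_diff tendsto_const
          isCont_tendsto_compose[OF f_cont] lim y_lim dk)
    then have u_lim: "?u \<longlonglongrightarrow> f xh + s"
      by simp
    have hk: "(\<lambda>q. h (\<kappa> q)) \<longlonglongrightarrow> M"
      by (rule filterlim_compose[OF h_lim \<kappa>])
    have "\<forall>\<^sub>F q in sequentially. h (\<kappa> q) \<le> ?u q"
      using pos
    proof eventually_elim
      case (elim q)
      then obtain n where n: "\<kappa> q = Suc n"
        by (cases "\<kappa> q") auto
      have "\<delta> / 2 * (norm (x (Suc n) - x n))\<^sup>2 \<le> \<delta> / 2 * (d n)\<^sup>2"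
        using \<delta> d(2)[of n] by (intro mult_left_mono power_mono) auto
      then show ?case
        using prox_r[OF s, of n] by (simp add: n h_def)
    qed
    then have "M \<le> f xh + s"
      by (rule tendsto_le[OF sequentially_bot u_lim hk])
    moreover have "limsup (\<lambda>q. H (zpair x (\<kappa> q))) = ereal M"
      using hk by (intro lim_imp_Limsup) (simp_all add: Hz)
    ultimately show ?thesis
      by (simp add: H_def potential_def objective_def s)
  qed

  \<comment> \<open>Norm of the subgradient\<close>
  have part3: "\<exists>w \<in> limiting_subdiff H (zpair x k).
      norm w \<le> sqrt 2 * ((L + inverse \<tau>min) * (1 + \<beta>max) + 2 * \<delta>) * norm (zpair x k - zpair x (k - 1))"
    if "1 \<le> k" for k
  proof -
    obtain n where n: "k = Suc n"
      using \<open>1 \<le> k\<close> by (cases k) auto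
    define p where "p = x (Suc n)"
    define w where "w = (gradient f p - (1 / \<tau> n) *\<^sub>R (p - (y n - \<tau> n *\<^sub>R gradient f (y n))) + \<delta> *\<^sub>R (p - x n),
      - \<delta> *\<^sub>R (p - x n))"
    have \<tau>n: "0 < \<tau> n"
      using \<tau>[of n] \<tau>min by linarith
    have "w \<in> regular_subdiff H (p, x n)"
      unfolding H_def w_def p_def using \<delta> by (intro potential_subgradient[OF f g prox \<tau>n]) simp
    then have mem: "w \<in> limiting_subdiff H (zpair x k)"
      using regular_subdiff_subset_limiting by (auto simp: n p_def zpair_def)
    have a: "norm (p - x n) \<le> d n"
      using d(2) by (simp add: p_def)
    have py: "norm (p - y n) \<le> (1 + \<beta>max) * d n"
      using norm_triangle_ineq4[of "p - x n" "y n - x n"] a y_x_d[of n] by (simp add: algebra_simps)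
    \<comment> \<open>The gradient at \<open>y n\<close> hidden in the proximal centre pairs with
      the gradient at \<open>p\<close>, so the Lipschitz bound applies to their difference.\<close>
    have "(1 / \<tau> n) *\<^sub>R (p - (y n - \<tau> n *\<^sub>R gradient f (y n))) = (1 / \<tau> n) *\<^sub>R (p - y n) + gradient f (y n)"
      using \<tau>n by (simp add: algebra_simps)
    then have fst_w: "fst w = (gradient f p - gradient f (y n)) - (1 / \<tau> n) *\<^sub>R (p - y n) + \<delta> *\<^sub>R (p - x n)"
      by (simp add: w_def)
    have "norm (fst w) \<le> norm (gradient f p - gradient f (y n)) + norm ((1 / \<tau> n) *\<^sub>R (p - y n)) + norm (\<delta> *\<^sub>R (p - x n))"
      unfolding fst_w by (intro norm_triangle_le add_right_mono norm_triangle_ineq4)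
    moreover have "norm ((1 / \<tau> n) *\<^sub>R (p - y n)) \<le> inverse \<tau>min * norm (p - y n)"
      using \<tau>n \<tau>min \<tau>[of n] by (simp add: divide_inverse mult.commute[of "norm (p - y n)"] mult_right_mono le_imp_inverse_le)
    moreover have "norm (\<delta> *\<^sub>R (p - x n)) \<le> \<delta> * d n"
      using a \<delta> by simp
    ultimately have "norm (fst w) \<le> (L + inverse \<tau>min) * norm (p - y n) + \<delta> * d n"
      using grad_lip[of p "y n"] by (simp add: distrib_right)
    also have "\<dots> \<le> (L + inverse \<tau>min) * ((1 + \<beta>max) * d n) + \<delta> * d n"
      using L \<tau>min by (intro add_right_mono mult_left_mono py) simp
    finally have "norm (fst w) \<le> (L + inverse \<tau>min) * ((1 + \<beta>max) * d n) + \<delta> * d n" .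
    moreover have "norm (snd w) \<le> \<delta> * d n"
      using a \<delta> by (simp add: w_def)
    \<comment> \<open>Each component contributes one \<delta>. Adding the component norms gives the
      estimate with factor 1, which is then enlarged to \<open>sqrt 2\<close>.\<close>
    ultimately have "norm w \<le> ((L + inverse \<tau>min) * (1 + \<beta>max) + 2 * \<delta>) * d n"
      using norm_Pair_le[of "fst w" "snd w"] by (simp add: algebra_simps)
    also have "\<dots> \<le> sqrt 2 * (((L + inverse \<tau>min) * (1 + \<beta>max) + 2 * \<delta>) * d n)"
    proof -
      have "0 \<le> ((L + inverse \<tau>min) * (1 + \<beta>max) + 2 * \<delta>) * d n"
        using L \<tau>min \<beta>max \<delta> d(1) by (intro mult_nonneg_nonneg add_nonneg_nonneg) auto
      from mult_right_mono[OF _ this, of 1 "sqrt 2"] show ?thesis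
        by simp
    qed
    finally show ?thesis
      using mem by (intro bexI[of _ w]) (simp_all add: n d_def mult.assoc)
  qed
  show ?thesis
    using part1 part2 part3 unfolding Let_def H_def[symmetric] by blast
qed

end
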